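(* For all integers $n\ge k\ge 0$, $$L^{Y}(n,k)=\sum_{l=k}^{n}{l \brace k}_{Y}{n \brack l}.$$
   Context: Let $Y$ be a real random variable with $E[|Y|^{n}]<\infty$ for all integers $n\ge 0$ and $\lim_{n\to\infty}|t|^{n}E[|Y|^{n}]/n!=0$ for $|t|<r$, for some $r>0$. Let $Y_1,Y_2,\dots$ be i.i.d. copies of $Y$, $S_0=0$ and $S_k=Y_1+\cdots+Y_k$. Let $\langle x\rangle_0=1$, $\langle x\rangle_n=x(x+1)\cdots(x+n-1)$. The probabilistic Lah numbers are $L^{Y}(n,k)=\frac{1}{k!}\sum_{l=0}^{k}\binom{k}{l}(-1)^{k-l}E[\langle S_{l}\rangle_{n}]$ (equivalently $\frac1{k!}(E[(1-t)^{-Y}]-1)^k=\sum_{n\ge k}L^Y(n,k)t^n/n!$). The probabilistic Stirling numbers of the second kind are ${n \brace k}_{Y}=\frac{1}{k!}\sum_{l=0}^{k}\binom{k}{l}(-1)^{k-l}E[S_{l}^{n}]$. The unsigned Stirling numbers of the first kind ${n\brack k}$ are defined by $\frac{1}{k!}\big(\log\frac{1}{1-t}\big)^{k}=\sum_{n\ge k}{n \brack k}\frac{t^{n}}{n!}$. *)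

theory Defs
  imports "HOL-Probability.Probability" "HOL-Combinatorics.Stirling"
begin

definition iid_copies :: "'b measure \<Rightarrow> ('b \<Rightarrow> real) \<Rightarrow> 'a measure \<Rightarrow> (nat \<Rightarrow> 'a \<Rightarrow> real) \<Rightarrow> bool"
  where "iid_copies N Y M Ys \<longleftrightarrow>
    prob_space.indep_vars M (\<lambda>_. borel) Ys {1..} \<and>
    (\<forall>i\<ge>1. distr M borel (Ys i) = distr N borel Y)"

definition partial_sum :: "(nat \<Rightarrow> 'a \<Rightarrow> real) \<Rightarrow> nat \<Rightarrow> 'a \<Rightarrow> real"
  where "partial_sum Ys k \<omega> = (\<Sum>i=1..k. Ys i \<omega>)"

text \<open>
  The numbers below depend only on the law of \<open>Y\<close>; they are expressed through a given
  sequence \<open>Ys 1, Ys 2, \<dots>\<close> of i.i.d. copies of \<open>Y\<close> on the probability space \<open>M\<close>.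
\<close>

definition prob_Lah :: "'a measure \<Rightarrow> (nat \<Rightarrow> 'a \<Rightarrow> real) \<Rightarrow> nat \<Rightarrow> nat \<Rightarrow> real"
  where "prob_Lah M Ys n k =
    1 / fact k * (\<Sum>l=0..k. real (k choose l) * (-1) ^ (k - l) *
      (LINT \<omega>|M. pochhammer (partial_sum Ys l \<omega>) n))"

definition prob_Stirling :: "'a measure \<Rightarrow> (nat \<Rightarrow> 'a \<Rightarrow> real) \<Rightarrow> nat \<Rightarrow> nat \<Rightarrow> real"
  where "prob_Stirling M Ys n k =
    1 / fact k * (\<Sum>l=0..k. real (k choose l) * (-1) ^ (k - l) *
      (LINT \<omega>|M. partial_sum Ys l \<omega> ^ n))"

text \<open>
  The library function \<open>stirling\<close> (unsigned, first kind) is given by its recurrence; the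
  following facts identify it with the coefficients of the exponential generating function
  \<open>log (1 / (1 - t)) ^ k / k!\<close>.
\<close>

lemma stirling_egf_deriv:
  fixes F :: "nat \<Rightarrow> real fps"
  defines "F \<equiv> \<lambda>k. Abs_fps (\<lambda>n. real (stirling n k) / fact n)"
  shows "(1 - fps_X) * fps_deriv (F (Suc k)) = F k"
proof (rule fps_ext)
  fix n
  have "fps_nth ((1 - fps_X) * fps_deriv (F (Suc k))) n =
      fps_nth (fps_deriv (F (Suc k))) n - fps_nth (fps_X * fps_deriv (F (Suc k))) n"
    by (simp add: algebra_simps)
  also have "fps_nth (fps_deriv (F (Suc k))) n = real (stirling (Suc n) (Suc k)) / fact n"
    by (simp add: F_def del: of_nat_Suc stirling.simps)
  also have "fps_nth (fps_X * fps_deriv (F (Suc k))) n = real n * real (stirling n (Suc k)) / fact n"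
    by (cases n) (simp_all add: F_def del: of_nat_Suc stirling.simps)
  also have "real (stirling (Suc n) (Suc k)) / fact n - real n * real (stirling n (Suc k)) / fact n =
      fps_nth (F k) n"
    by (simp add: F_def add_divide_distrib)
  finally show "fps_nth ((1 - fps_X) * fps_deriv (F (Suc k))) n = fps_nth (F k) n" .
qed

lemma stirling_egf_fps:
  "Abs_fps (\<lambda>n. real (stirling n k) / fact n) =
     fps_const (1 / fact k) * (Abs_fps (\<lambda>n. 1 / real n)) ^ k"
proof (induction k)
  case 0
  have "real (stirling n 0) / fact n = fps_nth (1 :: real fps) n" for n
    by (cases n) auto
  then show ?case by (auto simp: fps_eq_iff)
next
  case (Suc k)
  define L :: "real fps" where "L = Abs_fps (\<lambda>n. 1 / real n)"
  define F where "F = (\<lambda>k. Abs_fps (\<lambda>n. real (stirling n k) / fact n))"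
  have L': "(1 - fps_X) * fps_deriv L = 1"
  proof (rule fps_ext)
    fix n show "fps_nth ((1 - fps_X) * fps_deriv L) n = fps_nth (1 :: real fps) n"
      by (cases n) (auto simp: L_def algebra_simps simp del: of_nat_Suc)
  qed
  have pow: "fps_deriv (L ^ Suc k) = of_nat (Suc k) * fps_deriv L * L ^ k"
    by (subst fps_deriv_power') simp
  have "(1 - fps_X) * fps_deriv (fps_const (1 / fact (Suc k)) * L ^ Suc k) =
      fps_const (1 / fact (Suc k)) * (of_nat (Suc k) * L ^ k * ((1 - fps_X) * fps_deriv L))"
    unfolding fps_deriv_mult_const_left pow by (simp only: mult_ac)
  also have "\<dots> = fps_const (1 / fact (Suc k) * real (Suc k)) * L ^ k"
    unfolding L' by (simp add: fps_of_nat[symmetric] mult.assoc[symmetric] del: fact_Suc of_nat_Suc)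
  also have "1 / fact (Suc k) * real (Suc k) = 1 / fact k"
    by (simp del: of_nat_Suc)
  also have "fps_const (1 / fact k) * L ^ k = (1 - fps_X) * fps_deriv (F (Suc k))"
    using Suc.IH stirling_egf_deriv[of k] by (simp add: F_def L_def)
  finally have "(1 - fps_X) * fps_deriv (fps_const (1 / fact (Suc k)) * L ^ Suc k) =
      (1 - fps_X) * fps_deriv (F (Suc k))" .
  moreover have "(1 - fps_X :: real fps) \<noteq> 0"
  proof
    assume "1 - fps_X = (0 :: real fps)"
    then have "fps_nth (1 - fps_X :: real fps) 0 = 0" by simp
    then show False by simp
  qed
  ultimately have "fps_deriv (fps_const (1 / fact (Suc k)) * L ^ Suc k) = fps_deriv (F (Suc k))"
    by simp
  moreover have "fps_nth (fps_const (1 / fact (Suc k)) * L ^ Suc k) 0 = fps_nth (F (Suc k)) 0"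
    by (simp add: F_def L_def)
  ultimately have "fps_const (1 / fact (Suc k)) * L ^ Suc k = F (Suc k)"
    by (simp only: fps_deriv_eq_iff) simp
  then show ?case by (simp add: F_def L_def)
qed

lemma stirling_egf:
  "(\<lambda>t::real. 1 / fact k * ln (1 / (1 - t)) ^ k) has_fps_expansion
     Abs_fps (\<lambda>n. real (stirling n k) / fact n)"
proof -
  have sums: "(\<lambda>n. 1 / real n * t ^ n) sums ln (1 / (1 - t))" if "\<bar>t\<bar> < 1" for t :: real
  proof -
    have "(\<lambda>n. - ((- (- t)) ^ n) / of_nat n) sums ln (1 + (- t))"
      using that by (intro ln_series') auto
    from sums_minus[OF this] have "(\<lambda>n. 1 / real n * t ^ n) sums (- ln (1 - t))"
      by simp
    moreover have "- ln (1 - t) = ln (1 / (1 - t))"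
      using that by (simp add: ln_div)
    ultimately show ?thesis by simp
  qed
  have "eventually (\<lambda>t::real. \<bar>t\<bar> < 1) (nhds 0)"
    by (rule eventually_nhds_in_open[of "{-1<..<1}", THEN eventually_mono]) auto
  then have "eventually (\<lambda>t::real. eval_fps (Abs_fps (\<lambda>n. 1 / real n)) t = ln (1 / (1 - t))) (nhds 0)"
    by eventually_elim (use sums in \<open>auto simp: eval_fps_def sums_iff\<close>)
  moreover have "fps_conv_radius (Abs_fps (\<lambda>n. 1 / real n)) > 0"
  proof -
    have "conv_radius (\<lambda>n. 1 / real n) \<ge> ereal (norm (1 / 2 :: real))"
      using sums[of "1/2"] by (intro conv_radius_geI) (auto simp: sums_iff)
    then show ?thesis
      by (simp add: fps_conv_radius_def) (metis ereal_less(2) half_gt_zero less_le_trans zero_less_one)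
  qed
  ultimately have L: "(\<lambda>t::real. ln (1 / (1 - t))) has_fps_expansion Abs_fps (\<lambda>n. 1 / real n)"
    by (simp add: has_fps_expansion_def)
  have "(\<lambda>t::real. ln (1 / (1 - t)) ^ k) has_fps_expansion Abs_fps (\<lambda>n. 1 / real n) ^ k"
    by (induction k) (simp_all add: has_fps_expansion_mult L)
  then show ?thesis
    unfolding stirling_egf_fps by (intro has_fps_expansion_mult has_fps_expansion_const)
qed

end

theory Submission
  imports Defs
begin

text \<open>
  Expanding the rising factorial as \<open>\<langle>x\<rangle>\<^sub>n = (\<Sum>l\<le>n. stirling n l * x ^ l)\<close> and integrating gives the
  identity with the sum running over all \<open>l \<le> n\<close>. The terms with \<open>l < k\<close> vanish: by independence,
  the exponential generating function of the moments of \<open>S\<^sub>j\<close> is the \<open>j\<close>-th power of that of \<open>Y\<close>,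
  say \<open>G\<close>, so by the binomial theorem the probabilistic Stirling numbers are the coefficients of
  \<open>(G - 1) ^ k / k!\<close>, and \<open>G - 1\<close> has no constant term.
\<close>

text \<open>The formal moment generating function \<open>E[exp (t X)]\<close>, taken as a power
  series so that moment identities become coefficientwise algebra.\<close>

definition moment_egf :: "'a measure \<Rightarrow> ('a \<Rightarrow> real) \<Rightarrow> real fps"
  where "moment_egf M X = Abs_fps (\<lambda>m. (LINT \<omega>|M. X \<omega> ^ m) / fact m)"

lemma moment_egf_nth: "fps_nth (moment_egf M X) m = (LINT \<omega>|M. X \<omega> ^ m) / fact m"
  by (simp add: moment_egf_def)

context prob_space
begin

lemma indep_var_power_mult:
  fixes X Z :: "'a \<Rightarrow> real"
  assumes "indep_var borel X borel Z"
    and "\<And>m. integrable M (\<lambda>\<omega>. X \<omega> ^ m)" and "\<And>m. integrable M (\<lambda>\<omega>. Z \<omega> ^ m)"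
  shows "integrable M (\<lambda>\<omega>. X \<omega> ^ i * Z \<omega> ^ j)"
    and "expectation (\<lambda>\<omega>. X \<omega> ^ i * Z \<omega> ^ j) =
      expectation (\<lambda>\<omega>. X \<omega> ^ i) * expectation (\<lambda>\<omega>. Z \<omega> ^ j)"
proof -
  have "indep_var borel ((\<lambda>x. x ^ i) \<circ> X) borel ((\<lambda>x. x ^ j) \<circ> Z)"
    by (rule indep_var_compose[OF assms(1)]) measurable
  then have ind: "indep_var borel (\<lambda>\<omega>. X \<omega> ^ i) borel (\<lambda>\<omega>. Z \<omega> ^ j)"
    by (simp add: comp_def)
  show "integrable M (\<lambda>\<omega>. X \<omega> ^ i * Z \<omega> ^ j)"
    using indep_var_integrable[OF ind] assms by blast
  show "expectation (\<lambda>\<omega>. X \<omega> ^ i * Z \<omega> ^ j) =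
      expectation (\<lambda>\<omega>. X \<omega> ^ i) * expectation (\<lambda>\<omega>. Z \<omega> ^ j)"
    using indep_var_lebesgue_integral[OF ind] assms by blast
qed

lemma integrable_power_add_indep:
  fixes X Z :: "'a \<Rightarrow> real"
  assumes "indep_var borel X borel Z"
    and "\<And>m. integrable M (\<lambda>\<omega>. X \<omega> ^ m)" and "\<And>m. integrable M (\<lambda>\<omega>. Z \<omega> ^ m)"
  shows "integrable M (\<lambda>\<omega>. (X \<omega> + Z \<omega>) ^ m)"
  unfolding binomial_ring
  by (intro Bochner_Integration.integrable_sum)
    (simp add: mult.assoc indep_var_power_mult[OF assms])

text \<open>Since \<open>m choose i\<close> over \<open>fact m\<close> is
  \<open>1 / (fact i * fact (m - i))\<close>, the binomial expansion of the m-th moment, with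
  expectations factored by independence, is a Cauchy product.\<close>

lemma moment_egf_add_indep:
  fixes X Z :: "'a \<Rightarrow> real"
  assumes "indep_var borel X borel Z"
    and "\<And>m. integrable M (\<lambda>\<omega>. X \<omega> ^ m)" and "\<And>m. integrable M (\<lambda>\<omega>. Z \<omega> ^ m)"
  shows "moment_egf M (\<lambda>\<omega>. X \<omega> + Z \<omega>) = moment_egf M X * moment_egf M Z"
proof (rule fps_ext)
  fix m
  have "expectation (\<lambda>\<omega>. (X \<omega> + Z \<omega>) ^ m) =
      (\<Sum>i\<le>m. expectation (\<lambda>\<omega>. real (m choose i) * (X \<omega> ^ i * Z \<omega> ^ (m - i))))"
    unfolding binomial_ring mult.assoc
    by (intro Bochner_Integration.integral_sum)
      (simp add: indep_var_power_mult[OF assms])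
  also have "\<dots> = (\<Sum>i\<le>m. real (m choose i) *
      (expectation (\<lambda>\<omega>. X \<omega> ^ i) * expectation (\<lambda>\<omega>. Z \<omega> ^ (m - i))))"
    by (simp add: indep_var_power_mult[OF assms])
  finally show "fps_nth (moment_egf M (\<lambda>\<omega>. X \<omega> + Z \<omega>)) m =
      fps_nth (moment_egf M X * moment_egf M Z) m"
    by (simp add: moment_egf_nth fps_mult_nth atLeast0AtMost sum_divide_distrib binomial_fact)
qed

text \<open>Both claims share one induction: the product rule in the step for the series needs every
  power of the previous partial sum to be integrable.\<close>

lemma partial_sum_moments:
  fixes Ys :: "nat \<Rightarrow> 'a \<Rightarrow> real" and G :: "real fps"
  assumes indep: "indep_vars (\<lambda>_. borel) Ys {1..}"
    and int: "\<And>i m. 1 \<le> i \<Longrightarrow> integrable M (\<lambda>\<omega>. Ys i \<omega> ^ m)"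
    and egf: "\<And>i. 1 \<le> i \<Longrightarrow> moment_egf M (Ys i) = G"
  shows "(\<forall>m. integrable M (\<lambda>\<omega>. partial_sum Ys j \<omega> ^ m)) \<and>
    moment_egf M (partial_sum Ys j) = G ^ j"
proof (induction j)
  case 0
  show ?case
    by (auto simp: partial_sum_def moment_egf_nth fps_eq_iff power_0_left prob_space)
next
  case (Suc j)
  \<comment> \<open>Splitting off the last index makes the new summand independent of the sum of the
    earlier ones.\<close>
  have "indep_vars (\<lambda>_. borel) Ys (insert (Suc j) {1..j})"
    by (rule indep_vars_subset[OF indep]) auto
  then have ind: "indep_var borel (Ys (Suc j)) borel (partial_sum Ys j)"
    using indep_vars_sum[of "{1..j}" "Suc j" Ys] by (simp add: partial_sum_def[abs_def])
  have eq: "partial_sum Ys (Suc j) = (\<lambda>\<omega>. Ys (Suc j) \<omega> + partial_sum Ys j \<omega>)"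
    by (auto simp: partial_sum_def)
  show ?case
    unfolding eq using Suc.IH int egf
    by (simp add: integrable_power_add_indep[OF ind] moment_egf_add_indep[OF ind])
qed

lemma prob_Stirling_eq_fps_nth:
  assumes "\<And>j. moment_egf M (partial_sum Ys j) = G ^ j"
  shows "prob_Stirling M Ys l k = fact l / fact k * fps_nth ((G - 1) ^ k) l"
proof -
  have mom: "expectation (\<lambda>\<omega>. partial_sum Ys j \<omega> ^ l) = fact l * fps_nth (G ^ j) l" for j
    by (simp add: moment_egf_nth flip: assms)
  \<comment> \<open>The binomial theorem with second summand \<open>-1\<close>; the scalars sit in
    \<open>fps_const\<close>, so taking the l-th coefficient pulls them out.\<close>
  have "(G - 1) ^ k = (\<Sum>j\<le>k. fps_const (real (k choose j) * (-1) ^ (k - j)) * G ^ j)"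
    using binomial_ring[of G "-1" k]
    by (simp only: fps_of_nat fps_const_1_eq_1 diff_conv_add_uminus mult_ac
        flip: fps_const_mult fps_const_power fps_const_neg)
  then show ?thesis
    by (simp add: prob_Stirling_def mom fps_sum_nth atLeast0AtMost sum_distrib_left mult_ac)
qed

lemma prob_Stirling_eq_0:
  assumes "\<And>j. moment_egf M (partial_sum Ys j) = G ^ j" and "l < k"
  shows "prob_Stirling M Ys l k = 0"
proof -
  \<comment> \<open>The case \<open>j = 1\<close> shows that \<open>G\<close> itself is a moment
    series, so its constant term is the total mass.\<close>
  have "fps_nth G 0 = 1"
    using moment_egf_nth[of M "partial_sum Ys 1" 0] by (simp add: assms(1) prob_space)
  then have "fps_nth (G - 1) 0 = 0"
    by simp
  with \<open>l < k\<close> show ?thesis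
    by (simp add: prob_Stirling_eq_fps_nth[OF assms(1)] startsby_zero_power_prefix)
qed

lemma prob_Lah_eq_sum_prob_Stirling:
  assumes "\<And>j m. integrable M (\<lambda>\<omega>. partial_sum Ys j \<omega> ^ m)"
  shows "prob_Lah M Ys n k = (\<Sum>l\<le>n. prob_Stirling M Ys l k * real (stirling n l))"
proof -
  have "expectation (\<lambda>\<omega>. pochhammer (partial_sum Ys j \<omega>) n) =
      (\<Sum>l\<le>n. real (stirling n l) * expectation (\<lambda>\<omega>. partial_sum Ys j \<omega> ^ l))" for j
    by (simp add: assms flip: stirling_pochhammer)
  then have "prob_Lah M Ys n k = (\<Sum>j=0..k. \<Sum>l\<le>n. 1 / fact k * (real (k choose j) * (-1) ^ (k - j) *
      (real (stirling n l) * expectation (\<lambda>\<omega>. partial_sum Ys j \<omega> ^ l))))"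
    by (simp only: prob_Lah_def sum_distrib_left)
  \<comment> \<open>After the swap, the inner alternating sum over \<open>j\<close> for fixed
    \<open>l\<close> is the one defining \<open>prob_Stirling\<close>.\<close>
  also have "\<dots> = (\<Sum>l\<le>n. prob_Stirling M Ys l k * real (stirling n l))"
    by (subst sum.swap) (simp add: prob_Stirling_def sum_distrib_left sum_distrib_right mult_ac)
  finally show ?thesis .
qed

end

theorem theorem2p3:
  fixes N :: "'b measure" and Y :: "'b \<Rightarrow> real"
    and M :: "'a measure" and Ys :: "nat \<Rightarrow> 'a \<Rightarrow> real"
    and r :: real and n k :: nat
  assumes "prob_space N"
    and "Y \<in> borel_measurable N"
    and "\<And>m::nat. integrable N (\<lambda>\<omega>. \<bar>Y \<omega>\<bar> ^ m)"
    and "r > 0"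
    and "\<And>t::real. \<bar>t\<bar> < r \<Longrightarrow>
          (\<lambda>m::nat. \<bar>t\<bar> ^ m * (LINT \<omega>|N. \<bar>Y \<omega>\<bar> ^ m) / fact m) \<longlonglongrightarrow> 0"
    and "prob_space M"
    and "iid_copies N Y M Ys"
    and "k \<le> n"
  shows "prob_Lah M Ys n k = (\<Sum>l=k..n. prob_Stirling M Ys l k * real (stirling n l))"
proof -
  interpret prob_space M by fact
  \<comment> \<open>The guard \<open>1 \<le> i\<close> attaches to both facts;
    \<open>indep[of 1]\<close> below discharges it at \<open>i = 1\<close>.\<close>
  have indep: "indep_vars (\<lambda>_. borel) Ys {1..}"
    and law: "distr M borel (Ys i) = distr N borel Y" if "1 \<le> i" for i
    using \<open>iid_copies N Y M Ys\<close> that by (auto simp: iid_copies_def)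
  note [measurable] = \<open>Y \<in> borel_measurable N\<close>
  have meas: "Ys i \<in> borel_measurable M" if "1 \<le> i" for i
    using indep[of 1] that by (auto simp: indep_vars_def)
  have Y: "integrable N (\<lambda>\<omega>. Y \<omega> ^ m)" for m
    using assms(3)[of m] by (rule Bochner_Integration.integrable_bound) (auto simp: power_abs)
  \<comment> \<open>Moments depend only on the law, so they are transported from \<open>N\<close> to
    \<open>M\<close> through the common distribution on the reals.\<close>
  have int: "integrable M (\<lambda>\<omega>. Ys i \<omega> ^ m)" if "1 \<le> i" for i m
    using Y[of m] integrable_distr_eq[OF meas[OF that], of "\<lambda>x. x ^ m"]
      integrable_distr_eq[OF \<open>Y \<in> borel_measurable N\<close>, of "\<lambda>x. x ^ m"] law[OF that]
    by simp
  have egf: "moment_egf M (Ys i) = moment_egf N Y" if "1 \<le> i" for i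
    using integral_distr[OF meas[OF that], of "\<lambda>x. x ^ m" for m]
      integral_distr[OF \<open>Y \<in> borel_measurable N\<close>, of "\<lambda>x. x ^ m" for m] law[OF that]
    by (simp add: fps_eq_iff moment_egf_nth)
  note mom = partial_sum_moments[OF indep[of 1] int egf, simplified]
  have "prob_Lah M Ys n k = (\<Sum>l\<le>n. prob_Stirling M Ys l k * real (stirling n l))"
    by (rule prob_Lah_eq_sum_prob_Stirling) (simp add: mom)
  also have "\<dots> = (\<Sum>l=k..n. prob_Stirling M Ys l k * real (stirling n l))"
  proof (rule sum.mono_neutral_right)
    show "\<forall>l\<in>{..n} - {k..n}. prob_Stirling M Ys l k * real (stirling n l) = 0"
      using prob_Stirling_eq_0[of Ys "moment_egf N Y" _ k] mom by auto
  qed auto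
  finally show ?thesis .
qed

end
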